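(* The Markov order is a topological property of an $\epsilon$-machine. That is: let $M$ and $M'$ be two finite-state $\epsilon$-machines (of stationary processes $\mathcal{P}$ and $\mathcal{P}'$ respectively) having the same underlying labeled directed graph, i.e. the same alphabet $\mathcal{A}$, the same state set $Q$, and, for all $s,s'\in Q$ and $x\in\mathcal{A}$, the transition $s\xrightarrow{x}s'$ has positive probability in $M$ if and only if it has positive probability in $M'$. Then the processes $\mathcal{P}$ and $\mathcal{P}'$ have the same Markov order $R\in\{0,1,2,\dots\}\cup\{\infty\}$.
   Context: A process is a stationary joint probability distribution over bi-infinite sequences $\dots X_{-1}X_0X_1\dots$ with values in a finite alphabet $\mathcal{A}$. Write $X_{a:b}=X_aX_{a+1}\cdots X_{b-1}$ (empty if $a=b$), $X_{:0}=\dots X_{-2}X_{-1}$ for the past and $X_{0:}=X_0X_1\dots$ for the future. The Markov order of the process is $R=\min\{\ell\ge 0 : \Pr(X_0\mid X_{-\ell:0})=\Pr(X_0\mid X_{:0})\text{ almost surely}\}$, with $R=\infty$ if no such finite $\ell$ exists. Two pasts are causally equivalent if they induce the same conditional distribution over futures $X_{0:}$. The causal state $\mathcal{S}_t$ at time $t$ is the equivalence class of the past $X_{:t}$. The $\epsilon$-machine of the process is the hidden Markov model whose states are the causal states (those with positive stationary probability) and whose labeled transition probabilities are $\Pr(X_0=x,\mathcal{S}_1=s'\mid \mathcal{S}_0=s)$. It is unifilar: the current state and the emitted symbol determine the next state. It is the minimal unifilar presentation of the process. Distinct states of an $\epsilon$-machine have distinct conditional future distributions. The $\epsilon$-machine is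 finite-state if there are finitely many causal states. A quantity is called topological if it depends only on the underlying labeled graph and not on the values of the transition probabilities, for changes of probabilities that neither remove transitions nor make states merge (so that the result is again an $\epsilon$-machine on the same graph). *)

theory Defs
  imports "HOL-Probability.Probability"
begin

section \<open>Stationary processes\<close>

definition biseq_space :: "(int \<Rightarrow> 'a) measure" where
  "biseq_space = (\<Pi>\<^sub>M i\<in>UNIV. count_space UNIV)"

definition seq_space :: "(nat \<Rightarrow> 'a) measure" where
  "seq_space = (\<Pi>\<^sub>M i\<in>UNIV. count_space UNIV)"

definition stationary_process :: "(int \<Rightarrow> 'a::finite) measure \<Rightarrow> bool" where
  "stationary_process P \<longleftrightarrow>
     prob_space P \<and> sets P = sets biseq_space \<and> distr P P (\<lambda>\<omega> i. \<omega> (i + 1)) = P"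

text \<open>The word \<open>X\<^bsub>a:b\<^esub> = X\<^bsub>a\<^esub> \<dots> X\<^bsub>b-1\<^esub>\<close> is a list, empty if \<open>a = b\<close>.
  The past \<open>X\<^bsub>:t\<^esub>\<close> is read backwards from time \<open>t - 1\<close>, so pasts and futures
  both live in \<open>seq_space\<close> and pasts at different times can be compared.\<close>

definition word :: "int \<Rightarrow> int \<Rightarrow> (int \<Rightarrow> 'a) \<Rightarrow> 'a list" where
  "word a b \<omega> = map \<omega> [a..b - 1]"

definition past :: "int \<Rightarrow> (int \<Rightarrow> 'a) \<Rightarrow> nat \<Rightarrow> 'a" where
  "past t \<omega> n = \<omega> (t - 1 - int n)"

definition future :: "int \<Rightarrow> (int \<Rightarrow> 'a) \<Rightarrow> nat \<Rightarrow> 'a" where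
  "future t \<omega> n = \<omega> (t + int n)"


section \<open>Markov order\<close>

definition word_algebra :: "(int \<Rightarrow> 'a) measure \<Rightarrow> nat \<Rightarrow> (int \<Rightarrow> 'a) measure" where
  "word_algebra P l = vimage_algebra (space P) (word (- int l) 0) (count_space UNIV)"

definition past_algebra :: "(int \<Rightarrow> 'a) measure \<Rightarrow> (int \<Rightarrow> 'a) measure" where
  "past_algebra P = vimage_algebra (space P) (past 0) seq_space"

text \<open>The infimum of the empty set of extended naturals is \<open>\<infinity>\<close>.\<close>

definition markov_order :: "(int \<Rightarrow> 'a::finite) measure \<Rightarrow> enat" where
  "markov_order P = Inf {enat l | l.
     \<forall>x. AE \<omega> in P.
       real_cond_exp P (word_algebra P l) (indicat_real {\<omega>. \<omega> 0 = x}) \<omega> =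
       real_cond_exp P (past_algebra P) (indicat_real {\<omega>. \<omega> 0 = x}) \<omega>}"


section \<open>Causal states and epsilon-machines\<close>

text \<open>A regular version \<open>K\<close> of the conditional distribution of the future given the past;
  such a \<open>K\<close> is unique up to a null set of pasts.\<close>

definition cond_future_dist ::
    "(int \<Rightarrow> 'a::finite) measure \<Rightarrow> ((nat \<Rightarrow> 'a) \<Rightarrow> (nat \<Rightarrow> 'a) measure) \<Rightarrow> bool" where
  "cond_future_dist P K \<longleftrightarrow>
     K \<in> seq_space \<rightarrow>\<^sub>M prob_algebra seq_space \<and>
     (\<forall>B\<in>sets seq_space. AE \<omega> in P.
        measure (K (past 0 \<omega>)) B =
        real_cond_exp P (past_algebra P) (indicat_real {\<omega>. future 0 \<omega> \<in> B}) \<omega>)"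

definition causal_equiv ::
    "((nat \<Rightarrow> 'a) \<Rightarrow> (nat \<Rightarrow> 'a) measure) \<Rightarrow> ((nat \<Rightarrow> 'a) \<times> (nat \<Rightarrow> 'a)) set" where
  "causal_equiv K = {(p, p'). K p = K p'}"

definition causal_state ::
    "((nat \<Rightarrow> 'a) \<Rightarrow> (nat \<Rightarrow> 'a) measure) \<Rightarrow> int \<Rightarrow> (int \<Rightarrow> 'a) \<Rightarrow> (nat \<Rightarrow> 'a) set" where
  "causal_state K t \<omega> = causal_equiv K `` {past t \<omega>}"

definition positive_causal_states ::
    "(int \<Rightarrow> 'a) measure \<Rightarrow> ((nat \<Rightarrow> 'a) \<Rightarrow> (nat \<Rightarrow> 'a) measure) \<Rightarrow> (nat \<Rightarrow> 'a) set set" where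
  "positive_causal_states P K =
     {C \<in> UNIV // causal_equiv K. \<P>(\<omega> in P. causal_state K 0 \<omega> = C) > 0}"

record ('q, 'a) hmm =
  states :: "'q set"
  tprob :: "'q \<Rightarrow> 'a \<Rightarrow> 'q \<Rightarrow> real"

text \<open>States of a machine are names for causal states: \<open>c s\<close> is the causal state named \<open>s\<close>.
  Only the values of \<open>tprob M\<close> on \<open>states M\<close> matter.\<close>

definition epsilon_machine_via ::
    "(int \<Rightarrow> 'a::finite) measure \<Rightarrow> ((nat \<Rightarrow> 'a) \<Rightarrow> (nat \<Rightarrow> 'a) measure) \<Rightarrow>
     ('q \<Rightarrow> (nat \<Rightarrow> 'a) set) \<Rightarrow> ('q, 'a) hmm \<Rightarrow> bool" where
  "epsilon_machine_via P K c M \<longleftrightarrow>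
     bij_betw c (states M) (positive_causal_states P K) \<and>
     (\<forall>s\<in>states M. \<forall>x. \<forall>s'\<in>states M.
        tprob M s x s' =
        \<P>(\<omega> in P. \<omega> 0 = x \<and> causal_state K 1 \<omega> = c s' \<bar> causal_state K 0 \<omega> = c s))"

text \<open>As \<open>K\<close> may be changed arbitrarily on null sets of pasts, having finitely many causal
  states means that some version \<open>K\<close> has finitely many.\<close>

definition finite_epsilon_machine ::
    "(int \<Rightarrow> 'a::finite) measure \<Rightarrow> ('q, 'a) hmm \<Rightarrow> bool" where
  "finite_epsilon_machine P M \<longleftrightarrow>
     (\<exists>K c. cond_future_dist P K \<and> finite (UNIV // causal_equiv K) \<and>
            epsilon_machine_via P K c M)"

end

theory Submission
  imports Defs
begin

text \<open>Conditioning the future on the pasts at times \<open>0\<close> and \<open>1\<close> shows that the causal state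
  \<open>S\<^sub>1\<close> is determined by \<open>S\<^sub>0\<close> and \<open>X\<^sub>0\<close>. Hence a word \<open>w\<close> followed by a causal state \<open>s\<close> has positive
  probability exactly if the graph has a path labelled \<open>w\<close> that ends in \<open>s\<close>. The Markov condition
  at length \<open>l\<close> says that any two states which can follow the same word of length \<open>l\<close> give the same
  law to the next symbol. Each extension of such a word has a suffix of length \<open>l\<close> to which the
  condition applies again, so two such states agree on all finite futures and are equal. Thus the
  Markov condition at \<open>l\<close> holds exactly if all paths with the same label of length \<open>l\<close> end in the same
  state, which is a property of the graph alone.\<close>

section \<open>Cylinder sets\<close>

definition cylinder :: "'a list \<Rightarrow> (nat \<Rightarrow> 'a) set" where
  "cylinder u = {f. \<forall>i<length u. f i = u ! i}"

lemma space_seq_space [simp]: "space seq_space = UNIV"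
  by (simp add: seq_space_def space_PiM)

lemma measurable_seq_space_component [measurable]:
  "(\<lambda>f. f n) \<in> seq_space \<rightarrow>\<^sub>M count_space UNIV"
  unfolding seq_space_def by measurable

lemma measurable_seq_spaceI:
  assumes "\<And>n. (\<lambda>x. f x n) \<in> M \<rightarrow>\<^sub>M count_space UNIV"
  shows "f \<in> M \<rightarrow>\<^sub>M seq_space"
  unfolding seq_space_def by (rule measurable_PiM_single') (use assms in auto)

lemma cylinder_Nil [simp]: "cylinder [] = UNIV"
  by (simp add: cylinder_def)

lemma cylinder_Cons: "f \<in> cylinder (x # u) \<longleftrightarrow> f 0 = x \<and> f \<circ> Suc \<in> cylinder u"
  by (auto simp: cylinder_def less_Suc_eq_0_disj)

lemma cylinder_butlast: "f \<in> cylinder u \<Longrightarrow> f \<in> cylinder (butlast u)"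
  by (auto simp: cylinder_def nth_butlast)

lemma cylinder_iff_map: "f \<in> cylinder u \<longleftrightarrow> map f [0..<length u] = u"
proof
  assume "f \<in> cylinder u"
  then show "map f [0..<length u] = u" by (intro nth_equalityI) (auto simp: cylinder_def)
next
  assume "map f [0..<length u] = u"
  then have "map f [0..<length u] ! i = u ! i" for i by (rule arg_cong)
  moreover have "map f [0..<length u] ! i = f i" if "i < length u" for i using that by simp
  ultimately show "f \<in> cylinder u" by (simp add: cylinder_def)
qed

lemma sets_cylinder [measurable]: "cylinder u \<in> sets (seq_space :: (nat \<Rightarrow> 'a) measure)"
proof -
  have "{f \<in> space (seq_space :: (nat \<Rightarrow> 'a) measure). \<forall>i<length u. f i = u ! i} \<in> sets seq_space"
    by measurable
  then show ?thesis by (simp add: cylinder_def)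
qed

text \<open>Since the alphabet is finite, a set that restricts finitely many coordinates is a finite
  disjoint union of cylinders of one common length, and such sets determine a finite
  measure.\<close>

lemma prob_measure_eqI_cylinder:
  fixes M N :: "(nat \<Rightarrow> 'a::finite) measure"
  assumes M: "M \<in> space (prob_algebra seq_space)" and N: "N \<in> space (prob_algebra seq_space)"
    and eq: "\<And>u. measure M (cylinder u) = measure N (cylinder u)"
  shows "M = N"
proof -
  have sets_M [measurable_cong]: "sets M = sets seq_space"
    and sets_N [measurable_cong]: "sets N = sets seq_space"
    using M N by (auto simp: space_prob_algebra)
  interpret M: prob_space M using M by (simp add: space_prob_algebra)
  interpret N: prob_space N using N by (simp add: space_prob_algebra)
  show ?thesis
  proof (rule measure_eqI_PiM_infinite)
    show "sets M = sets (\<Pi>\<^sub>M i\<in>UNIV. count_space UNIV)"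
      and "sets N = sets (\<Pi>\<^sub>M i\<in>UNIV. count_space UNIV)"
      using sets_M sets_N by (simp_all add: seq_space_def)
    show "finite_measure M" by (rule M.finite_measure_axioms)
  next
    fix A :: "nat \<Rightarrow> 'a set" and J :: "nat set"
    assume J: "finite J"
    \<comment> \<open>A length that covers every coordinate in \<open>J\<close>; inserting
      \<open>0\<close> keeps \<open>Max\<close> meaningful when \<open>J\<close> is empty.\<close>
    define n where "n = Suc (Max (insert 0 J))"
    have n: "j < n" if "j \<in> J" for j
      using J that by (simp add: n_def less_Suc_eq_le)
    define U where "U = {u. set u \<subseteq> UNIV \<and> length u = n \<and> (\<forall>j\<in>J. u ! j \<in> A j)}"
    have "finite U"
      by (rule finite_subset[OF _ finite_lists_length_eq[of UNIV n]]) (auto simp: U_def)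
    have emb: "prod_emb UNIV (\<lambda>_. count_space UNIV) J (Pi\<^sub>E J A) = (\<Union>u\<in>U. cylinder u)"
    proof (intro set_eqI iffI)
      fix f assume "f \<in> prod_emb UNIV (\<lambda>_. count_space UNIV) J (Pi\<^sub>E J A)"
      then have "map f [0..<n] \<in> U"
        using n by (auto simp: U_def prod_emb_def PiE_def Pi_def)
      moreover have "f \<in> cylinder (map f [0..<n])" by (simp add: cylinder_def)
      ultimately show "f \<in> (\<Union>u\<in>U. cylinder u)" by blast
    next
      fix f assume "f \<in> (\<Union>u\<in>U. cylinder u)"
      then obtain u where u: "u \<in> U" "f \<in> cylinder u" by blast
      then have "f j \<in> A j" if "j \<in> J" for j
        using n[OF that] that by (auto simp: U_def cylinder_def)
      then show "f \<in> prod_emb UNIV (\<lambda>_. count_space UNIV) J (Pi\<^sub>E J A)"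
        by (auto simp: prod_emb_def restrict_def)
    qed
    have disj: "disjoint_family_on cylinder U"
      by (auto simp: disjoint_family_on_def U_def cylinder_iff_map)
    have "measure M (\<Union>u\<in>U. cylinder u) = (\<Sum>u\<in>U. measure M (cylinder u))"
      using \<open>finite U\<close> disj by (intro M.finite_measure_finite_Union) (auto simp: sets_M)
    also have "\<dots> = measure N (\<Union>u\<in>U. cylinder u)"
      unfolding eq using \<open>finite U\<close> disj
      by (intro N.finite_measure_finite_Union[symmetric]) (auto simp: sets_N)
    finally show "emeasure M (prod_emb UNIV (\<lambda>_. count_space UNIV) J (Pi\<^sub>E J A)) =
        emeasure N (prod_emb UNIV (\<lambda>_. count_space UNIV) J (Pi\<^sub>E J A))"
      by (simp add: emb M.emeasure_eq_measure N.emeasure_eq_measure)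
  qed
qed

lemma past_one: "past 1 \<omega> 0 = \<omega> 0" "past 1 \<omega> \<circ> Suc = past 0 \<omega>"
  by (auto simp: past_def fun_eq_iff diff_diff_eq)

lemma future_zero: "future 0 \<omega> 0 = \<omega> 0" "future 0 \<omega> \<circ> Suc = future 1 \<omega>"
  by (auto simp: future_def fun_eq_iff)

text \<open>Words run forwards in time and pasts backwards, hence the reversal.\<close>

lemma word_eq_rev_past: "word (- int l) 0 \<omega> = rev (map (past 0 \<omega>) [0..<l])"
proof (rule nth_equalityI)
  show "word (- int l) 0 \<omega> ! i = rev (map (past 0 \<omega>) [0..<l]) ! i"
    if "i < length (word (- int l) 0 \<omega>)" for i
    using that by (simp add: word_def past_def rev_nth)
qed (simp add: word_def)

lemma word_eq_iff_cylinder: "word (- int (length v)) 0 \<omega> = rev v \<longleftrightarrow> past 0 \<omega> \<in> cylinder v"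
  by (simp add: word_eq_rev_past cylinder_iff_map)


section \<open>The process seen through its causal states\<close>

text \<open>A causal state is represented by the conditional future distribution \<open>m = K p\<close> of its pasts
  \<open>p\<close>, and a past word by the prefix \<open>v\<close> of the reversed past.\<close>

locale causal_process =
  fixes P :: "(int \<Rightarrow> 'a::finite) measure" and K :: "(nat \<Rightarrow> 'a) \<Rightarrow> (nat \<Rightarrow> 'a) measure"
  assumes stationary: "stationary_process P"
    and cond_future: "cond_future_dist P K"
    and finite_range: "finite (range K)"
begin

lemma prob_space_P: "prob_space P"
  and sets_P [measurable_cong]: "sets P = sets biseq_space"
  and shift_P: "distr P P (\<lambda>\<omega> i. \<omega> (i + 1)) = P"
  using stationary by (auto simp: stationary_process_def)

sublocale prob_space P by (rule prob_space_P)

lemma space_P [simp]: "space P = UNIV"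
  using sets_eq_imp_space_eq[OF sets_P] by (simp add: biseq_space_def space_PiM)

lemma measurable_P_component [measurable]: "(\<lambda>\<omega>. \<omega> i) \<in> P \<rightarrow>\<^sub>M count_space UNIV"
proof -
  have "(\<lambda>\<omega>. \<omega> i) \<in> biseq_space \<rightarrow>\<^sub>M count_space UNIV"
    unfolding biseq_space_def by measurable
  then show ?thesis by (simp add: measurable_cong_sets[OF sets_P refl])
qed

lemma measurable_past [measurable]: "past t \<in> P \<rightarrow>\<^sub>M seq_space"
  by (rule measurable_seq_spaceI) (simp add: past_def)

lemma measurable_future [measurable]: "future t \<in> P \<rightarrow>\<^sub>M seq_space"
  by (rule measurable_seq_spaceI) (simp add: future_def)

lemma measurable_shift: "(\<lambda>\<omega> i. \<omega> (i + 1)) \<in> P \<rightarrow>\<^sub>M P"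
proof -
  have "(\<lambda>\<omega> i. \<omega> (i + 1)) \<in> P \<rightarrow>\<^sub>M biseq_space"
    unfolding biseq_space_def by (rule measurable_PiM_single') auto
  then show ?thesis by (simp add: measurable_cong_sets[OF refl sets_P])
qed

text \<open>Stationarity in the form used below: it moves statements about time \<open>0\<close> to
  time \<open>1\<close>.\<close>

lemma prob_shift:
  assumes [measurable]: "Measurable.pred P Q"
  shows "prob {\<omega>. Q (\<lambda>i. \<omega> (i + 1))} = prob {\<omega>. Q \<omega>}"
proof -
  have "prob {\<omega>. Q \<omega>} = measure (distr P P (\<lambda>\<omega> i. \<omega> (i + 1))) {\<omega>. Q \<omega>}"
    by (simp add: shift_P)
  also have "\<dots> = prob ((\<lambda>\<omega> i. \<omega> (i + 1)) -` {\<omega>. Q \<omega>} \<inter> space P)"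
    using pred_sets2[OF sets.top] assms
    by (intro measure_distr measurable_shift) (simp add: pred_def)
  finally show ?thesis by (simp add: vimage_def)
qed

lemma past_shift: "past t (\<lambda>i. \<omega> (i + 1)) = past (t + 1) \<omega>"
  by (simp add: past_def fun_eq_iff algebra_simps)

lemma future_shift: "future t (\<lambda>i. \<omega> (i + 1)) = future (t + 1) \<omega>"
  by (simp add: future_def fun_eq_iff algebra_simps)

lemma measurable_K [measurable]: "K \<in> seq_space \<rightarrow>\<^sub>M prob_algebra seq_space"
  using cond_future by (simp add: cond_future_dist_def)

lemma K_in_prob_algebra: "K p \<in> space (prob_algebra seq_space)"
  using measurable_space[OF measurable_K, of p] by simp

lemma K_eqI:
  assumes "m \<in> range K" "m' \<in> range K" "\<And>u. measure m (cylinder u) = measure m' (cylinder u)"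
  shows "m = m'"
  using assms by (auto intro: prob_measure_eqI_cylinder K_in_prob_algebra)

lemma measure_K_UNIV [simp]: "measure (K p) UNIV = 1"
proof -
  have "prob_space (K p)" "sets (K p) = sets seq_space"
    using K_in_prob_algebra[of p] by (auto simp: space_prob_algebra)
  from prob_space.prob_space[OF this(1)] sets_eq_imp_space_eq[OF this(2)]
  show ?thesis by simp
qed

text \<open>There are only countably many words, so equality with a fixed value of \<open>K\<close>
  is a countable conjunction of measurable conditions on cylinder probabilities.\<close>

lemma pred_K_eq [measurable]: "Measurable.pred seq_space (\<lambda>p. K p = m)"
proof (cases "m \<in> range K")
  case True
  then have "K p = m \<longleftrightarrow> (\<forall>u. measure (K p) (cylinder u) = measure m (cylinder u))" for p
    using K_eqI by blast
  then show ?thesis by simp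
next
  case False
  then have "K p \<noteq> m" for p by blast
  then show ?thesis by simp
qed

lemma subalgebra_past: "subalgebra P (past_algebra P)"
  unfolding subalgebra_def past_algebra_def
  using measurable_sets[OF measurable_past[of 0]]
  by (auto simp: sets_vimage_algebra2)

sublocale past: finite_measure_subalgebra P "past_algebra P"
  by unfold_locales (rule subalgebra_past)

lemma measurable_past_algebra: "past 0 \<in> past_algebra P \<rightarrow>\<^sub>M seq_space"
  unfolding past_algebra_def by (rule measurable_vimage_algebra1) simp

lemma cond_future_AE:
  assumes "B \<in> sets seq_space"
  shows "AE \<omega> in P. measure (K (past 0 \<omega>)) B =
     real_cond_exp P (past_algebra P) (indicat_real {\<omega>. future 0 \<omega> \<in> B}) \<omega>"
  using cond_future assms by (simp add: cond_future_dist_def)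

text \<open>Given the causal state, the rest of the past says nothing more about the future. The
  condition on the past is an event of \<open>past_algebra P\<close>, so the conditional probability
  may be integrated over it, and there it is almost surely the constant
  \<open>measure m (cylinder u)\<close>.\<close>

lemma prob_past_future:
  assumes [measurable]: "Measurable.pred seq_space Q"
  shows "prob {\<omega>. Q (past 0 \<omega>) \<and> K (past 0 \<omega>) = m \<and> future 0 \<omega> \<in> cylinder u} =
    prob {\<omega>. Q (past 0 \<omega>) \<and> K (past 0 \<omega>) = m} * measure m (cylinder u)"
proof -
  let ?A = "{\<omega>. Q (past 0 \<omega>) \<and> K (past 0 \<omega>) = m}"
  let ?F = "{\<omega>. future 0 \<omega> \<in> cylinder u}"
  have "?A = past 0 -` {p \<in> space seq_space. Q p \<and> K p = m} \<inter> space P" by auto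
  also have "\<dots> \<in> sets (past_algebra P)"
    unfolding past_algebra_def by (rule in_vimage_algebra) measurable
  finally have A: "?A \<in> sets (past_algebra P)" .
  have "{\<omega> \<in> space P. Q (past 0 \<omega>) \<and> K (past 0 \<omega>) = m} \<in> sets P" by measurable
  then have AP: "?A \<in> sets P" by simp
  have "{\<omega> \<in> space P. future 0 \<omega> \<in> cylinder u} \<in> sets P" by measurable
  then have F: "?F \<in> sets P" by simp
  have "prob (?A \<inter> ?F) = (\<integral>\<omega>\<in>?A. indicat_real ?F \<omega> \<partial>P)"
    using AP F by (simp add: set_lebesgue_integral_def flip: indicator_inter_arith)
  also have "\<dots> = (\<integral>\<omega>\<in>?A. real_cond_exp P (past_algebra P) (indicat_real ?F) \<omega> \<partial>P)"
    using F A by (intro past.real_cond_exp_intA) (auto simp: emeasure_eq_measure)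
  also have "\<dots> = (\<integral>\<omega>\<in>?A. measure m (cylinder u) \<partial>P)"
    unfolding set_lebesgue_integral_def
  proof (rule integral_cong_AE)
    show "AE \<omega> in P. indicat_real ?A \<omega> *\<^sub>R real_cond_exp P (past_algebra P) (indicat_real ?F) \<omega> =
        indicat_real ?A \<omega> *\<^sub>R measure m (cylinder u)"
      using cond_future_AE[OF sets_cylinder[of u]] by eventually_elim (auto simp: indicator_def)
  qed (use AP in auto)
  also have "\<dots> = prob ?A * measure m (cylinder u)"
    using AP by (simp add: set_lebesgue_integral_def)
  finally show ?thesis by (simp add: Int_def conj_assoc)
qed

lemma events_Collect: "Measurable.pred P Q \<Longrightarrow> {\<omega>. Q \<omega>} \<in> events"
  by (simp add: pred_def)

lemma prob_pos_mono:
  assumes "Measurable.pred P R" "prob {\<omega>. Q \<omega>} > 0" "\<And>\<omega>. Q \<omega> \<Longrightarrow> R \<omega>"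
  shows "prob {\<omega>. R \<omega>} > 0"
proof -
  have "prob {\<omega>. Q \<omega>} \<le> prob {\<omega>. R \<omega>}"
    using assms by (intro finite_measure_mono events_Collect) auto
  with assms show ?thesis by simp
qed

text \<open>If all slices were null, so would be their finite union.\<close>

lemma prob_pos_split:
  assumes [measurable]: "Measurable.pred P Q" and f: "\<And>m. Measurable.pred P (\<lambda>\<omega>. f \<omega> = m)"
    and fin: "finite (range f)" and pos: "prob {\<omega>. Q \<omega>} > 0"
  shows "\<exists>m\<in>range f. prob {\<omega>. Q \<omega> \<and> f \<omega> = m} > 0"
proof (rule ccontr)
  assume neg: "\<not> ?thesis"
  have "prob {\<omega>. Q \<omega> \<and> f \<omega> = m} = 0" if "m \<in> range f" for m
    using neg that measure_nonneg[of P "{\<omega>. Q \<omega> \<and> f \<omega> = m}"] by (metis less_eq_real_def)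
  moreover have "{\<omega>. Q \<omega>} = (\<Union>m\<in>range f. {\<omega>. Q \<omega> \<and> f \<omega> = m})" by auto
  moreover have "prob (\<Union>m\<in>range f. {\<omega>. Q \<omega> \<and> f \<omega> = m}) \<le> (\<Sum>m\<in>range f. prob {\<omega>. Q \<omega> \<and> f \<omega> = m})"
    using fin f by (intro finite_measure_subadditive_finite) (auto intro!: events_Collect)
  ultimately show False using pos by simp
qed

lemma finite_range_past: "finite (range (\<lambda>\<omega>. K (past t \<omega>)))"
  by (rule finite_subset[OF _ finite_range]) auto

section \<open>Positive transitions and the Markov condition\<close>

text \<open>A joint probability instead of a conditional one: there is no division by the
  probability of \<open>m\<close>, and edges leave only states of positive probability.\<close>

definition edge :: "(nat \<Rightarrow> 'a) measure \<Rightarrow> 'a \<Rightarrow> (nat \<Rightarrow> 'a) measure \<Rightarrow> bool" where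
  "edge m x m' \<longleftrightarrow> prob {\<omega>. K (past 0 \<omega>) = m \<and> \<omega> 0 = x \<and> K (past 1 \<omega>) = m'} > 0"

definition pos :: "'a list \<Rightarrow> (nat \<Rightarrow> 'a) measure \<Rightarrow> bool" where
  "pos v m \<longleftrightarrow> prob {\<omega>. past 0 \<omega> \<in> cylinder v \<and> K (past 0 \<omega>) = m} > 0"

lemma prob_pos_ex: "prob {\<omega>. Q \<omega>} > 0 \<Longrightarrow> \<exists>\<omega>. Q \<omega>"
  by (rule ccontr) simp

lemma edge_range:
  assumes "edge m x m'" shows "m \<in> range K" "m' \<in> range K"
  using prob_pos_ex[OF assms[unfolded edge_def]] by auto

lemma pos_range: "pos v m \<Longrightarrow> m \<in> range K"
  unfolding pos_def by (drule prob_pos_ex) auto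

text \<open>As \<open>v\<close> lists the most recent symbol first, \<open>butlast\<close> forgets
  the oldest one.\<close>

lemma pos_butlast: "pos v m \<Longrightarrow> pos (butlast v) m"
  unfolding pos_def by (erule prob_pos_mono[rotated]) (auto dest: cylinder_butlast)

text \<open>By stationarity the event may be read one step later, where the newest symbol
  \<open>x\<close> is the one emitted at time \<open>0\<close>.\<close>

lemma pos_Cons_iff_past1:
  "pos (x # v) m \<longleftrightarrow>
    prob {\<omega>. past 0 \<omega> \<in> cylinder v \<and> \<omega> 0 = x \<and> K (past 1 \<omega>) = m} > 0"
proof -
  have "prob {\<omega>. past 0 \<omega> \<in> cylinder (x # v) \<and> K (past 0 \<omega>) = m} =
    prob {\<omega>. past 1 \<omega> \<in> cylinder (x # v) \<and> K (past 1 \<omega>) = m}"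
    using prob_shift[of "\<lambda>\<omega>. past 0 \<omega> \<in> cylinder (x # v) \<and> K (past 0 \<omega>) = m"]
    by (simp add: past_shift)
  then show ?thesis
    by (simp add: pos_def cylinder_Cons past_one conj_ac)
qed

lemma past_one_eq_case_nat: "past 1 \<omega> = case_nat (\<omega> 0) (past 0 \<omega>)"
  using past_one[of \<omega>] by (auto simp: fun_eq_iff split: nat.split)

lemma measurable_case_nat_seq [measurable]: "case_nat x \<in> seq_space \<rightarrow>\<^sub>M seq_space"
proof (rule measurable_seq_spaceI)
  show "(\<lambda>p. case_nat x p n) \<in> seq_space \<rightarrow>\<^sub>M count_space UNIV" for n
    by (cases n) simp_all
qed

text \<open>Both sides of the product formula evaluate
  \<open>Pr(S\<^sub>0 = m, X\<^sub>0 = x, S\<^sub>1 = m', X\<^bsub>1:\<^esub> = u)\<close>, once by conditioning on the past at time \<open>0\<close> and once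
  at time \<open>1\<close>.\<close>

lemma edge_future:
  assumes "edge m x m'"
  shows "measure m (cylinder [x]) > 0"
    and "measure m (cylinder (x # u)) = measure m (cylinder [x]) * measure m' (cylinder u)"
proof -
  \<comment> \<open>\<open>a\<close> does not ask for \<open>\<omega> 0 = x\<close>. Once that
    symbol is fixed by the future \<open>x # u\<close>, the condition
    \<open>K (past 1 \<omega>) = m'\<close> becomes
    \<open>K (case_nat x (past 0 \<omega>)) = m'\<close>, which concerns the past at time
    \<open>0\<close> alone.\<close>
  define a where "a = prob {\<omega>. K (case_nat x (past 0 \<omega>)) = m' \<and> K (past 0 \<omega>) = m}"
  define e where "e = prob {\<omega>. K (past 0 \<omega>) = m \<and> \<omega> 0 = x \<and> K (past 1 \<omega>) = m'}"
  have e0: "e > 0" using assms by (simp add: e_def edge_def)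
  have time0: "prob {\<omega>. K (past 0 \<omega>) = m \<and> \<omega> 0 = x \<and> K (past 1 \<omega>) = m' \<and> future 1 \<omega> \<in> cylinder u} =
      a * measure m (cylinder (x # u))" for u
  proof -
    have "Measurable.pred seq_space (\<lambda>p. K (case_nat x p) = m')" by measurable
    from prob_past_future[OF this, of m "x # u"]
    have "prob {\<omega>. K (case_nat x (past 0 \<omega>)) = m' \<and> K (past 0 \<omega>) = m \<and> future 0 \<omega> \<in> cylinder (x # u)} =
      a * measure m (cylinder (x # u))"
      by (simp add: a_def)
    also have "{\<omega>. K (case_nat x (past 0 \<omega>)) = m' \<and> K (past 0 \<omega>) = m \<and> future 0 \<omega> \<in> cylinder (x # u)} =
      {\<omega>. K (past 0 \<omega>) = m \<and> \<omega> 0 = x \<and> K (past 1 \<omega>) = m' \<and> future 1 \<omega> \<in> cylinder u}"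
      by (auto simp: cylinder_Cons past_one_eq_case_nat future_zero)
    finally show ?thesis .
  qed
  have time1: "prob {\<omega>. K (past 0 \<omega>) = m \<and> \<omega> 0 = x \<and> K (past 1 \<omega>) = m' \<and> future 1 \<omega> \<in> cylinder u} =
      e * measure m' (cylinder u)" for u
  proof -
    have "(\<lambda>p :: nat \<Rightarrow> 'a. p \<circ> Suc) \<in> seq_space \<rightarrow>\<^sub>M seq_space"
      by (rule measurable_seq_spaceI) simp
    then have [measurable]: "Measurable.pred seq_space (\<lambda>p. K (p \<circ> Suc) = m)"
      by (rule measurable_compose[where g = "\<lambda>p. K p = m"]) measurable
    have [measurable]: "Measurable.pred seq_space (\<lambda>p. p 0 = x \<and> K (p \<circ> Suc) = m)" by measurable
    \<comment> \<open>The past at time \<open>1\<close> contains both the symbol \<open>x\<close>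
      and, once that is dropped, the past at time \<open>0\<close>; so the symbol and the old state
      are conditions on this past.\<close>
    have "prob {\<omega>. (past 1 \<omega> 0 = x \<and> K (past 1 \<omega> \<circ> Suc) = m) \<and> K (past 1 \<omega>) = m' \<and> future 1 \<omega> \<in> cylinder u}
      = prob {\<omega>. (past 1 \<omega> 0 = x \<and> K (past 1 \<omega> \<circ> Suc) = m) \<and> K (past 1 \<omega>) = m'} * measure m' (cylinder u)"
      using prob_past_future[of "\<lambda>p. p 0 = x \<and> K (p \<circ> Suc) = m" m' u]
        prob_shift[of "\<lambda>\<omega>. (past 0 \<omega> 0 = x \<and> K (past 0 \<omega> \<circ> Suc) = m) \<and> K (past 0 \<omega>) = m' \<and> future 0 \<omega> \<in> cylinder u"]
        prob_shift[of "\<lambda>\<omega>. (past 0 \<omega> 0 = x \<and> K (past 0 \<omega> \<circ> Suc) = m) \<and> K (past 0 \<omega>) = m'"]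
      by (simp add: past_shift future_shift)
    then show ?thesis
      by (simp add: e_def past_one conj_ac)
  qed
  have *: "a * measure m (cylinder (x # u)) = e * measure m' (cylinder u)" for u
    using time0 time1 by simp
  \<comment> \<open>The empty word identifies \<open>e\<close> as
    \<open>a * measure m (cylinder [x])\<close>. Since \<open>e\<close> is positive, both factors
    are nonzero and \<open>a\<close> can be cancelled.\<close>
  have "measure m' UNIV = 1" using edge_range(2)[OF assms] by auto
  with *[of "[]"] have ae: "a * measure m (cylinder [x]) = e" by simp
  then have "a \<noteq> 0" "measure m (cylinder [x]) \<noteq> 0" using e0 by auto
  then show "measure m (cylinder [x]) > 0" by (simp add: zero_less_measure_iff)
  have "a * measure m (cylinder (x # u)) = a * (measure m (cylinder [x]) * measure m' (cylinder u))"
    using * ae by (simp add: mult.assoc[symmetric])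
  with \<open>a \<noteq> 0\<close>
  show "measure m (cylinder (x # u)) = measure m (cylinder [x]) * measure m' (cylinder u)" by simp
qed

text \<open>By the product formula both targets give \<open>u\<close> the probability of
  \<open>x # u\<close> under \<open>m\<close> divided by that of \<open>[x]\<close>, and cylinders
  separate the values of \<open>K\<close>.\<close>

lemma edge_unifilar:
  assumes "edge m x m'" "edge m x m''"
  shows "m' = m''"
proof (rule K_eqI)
  show "measure m' (cylinder u) = measure m'' (cylinder u)" for u
    using edge_future[OF assms(1)] edge_future(2)[OF assms(2)]
    by (metis less_irrefl mult_cancel_left)
qed (use assms edge_range in blast)+

lemma pos_extend:
  assumes "pos v m" "measure m (cylinder [x]) > 0"
  shows "\<exists>m'. edge m x m' \<and> pos (x # v) m'"
proof -
  have "prob {\<omega>. past 0 \<omega> \<in> cylinder v \<and> K (past 0 \<omega>) = m \<and> future 0 \<omega> \<in> cylinder [x]} =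
    prob {\<omega>. past 0 \<omega> \<in> cylinder v \<and> K (past 0 \<omega>) = m} * measure m (cylinder [x])"
    by (rule prob_past_future) measurable
  then have "prob {\<omega>. past 0 \<omega> \<in> cylinder v \<and> K (past 0 \<omega>) = m \<and> \<omega> 0 = x} > 0"
    using assms by (simp add: pos_def cylinder_Cons future_zero)
  then have "\<exists>m'\<in>range (\<lambda>\<omega>. K (past 1 \<omega>)).
      prob {\<omega>. (past 0 \<omega> \<in> cylinder v \<and> K (past 0 \<omega>) = m \<and> \<omega> 0 = x) \<and> K (past 1 \<omega>) = m'} > 0"
    by (intro prob_pos_split finite_range_past) measurable
  then obtain m' where m':
    "prob {\<omega>. (past 0 \<omega> \<in> cylinder v \<and> K (past 0 \<omega>) = m \<and> \<omega> 0 = x) \<and> K (past 1 \<omega>) = m'} > 0"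
    by blast
  have "edge m x m'"
    unfolding edge_def by (rule prob_pos_mono[OF _ m']) auto
  moreover have "pos (x # v) m'"
    unfolding pos_Cons_iff_past1 by (rule prob_pos_mono[OF _ m']) auto
  ultimately show ?thesis by blast
qed

lemma pos_Cons: "pos (x # v) m' \<longleftrightarrow> (\<exists>m. pos v m \<and> edge m x m')"
proof
  assume "pos (x # v) m'"
  then have "\<exists>m\<in>range (\<lambda>\<omega>. K (past 0 \<omega>)).
      prob {\<omega>. (past 0 \<omega> \<in> cylinder v \<and> \<omega> 0 = x \<and> K (past 1 \<omega>) = m') \<and> K (past 0 \<omega>) = m} > 0"
    unfolding pos_Cons_iff_past1 by (intro prob_pos_split finite_range_past) measurable
  then obtain m where m:
    "prob {\<omega>. (past 0 \<omega> \<in> cylinder v \<and> \<omega> 0 = x \<and> K (past 1 \<omega>) = m') \<and> K (past 0 \<omega>) = m} > 0"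
    by blast
  have "pos v m"
    unfolding pos_def by (rule prob_pos_mono[OF _ m]) auto
  moreover have "edge m x m'"
    unfolding edge_def by (rule prob_pos_mono[OF _ m]) auto
  ultimately show "\<exists>m. pos v m \<and> edge m x m'" by blast
next
  assume "\<exists>m. pos v m \<and> edge m x m'"
  then obtain m where m: "pos v m" "edge m x m'" by blast
  \<comment> \<open>The word and the edge are each possible from \<open>m\<close>, but not yet known
    to occur jointly. Extending the word by \<open>x\<close> reaches some state along an edge, and
    unifilarity forces it to be \<open>m'\<close>.\<close>
  from pos_extend[OF m(1) edge_future(1)[OF m(2)]] edge_unifilar[OF m(2)]
  show "pos (x # v) m'" by blast
qed

text \<open>Only finitely many pairs of a word of length \<open>l\<close> and a state exist, so the
  null ones can be discarded together.\<close>

lemma AE_pos: "AE \<omega> in P. pos (map (past 0 \<omega>) [0..<l]) (K (past 0 \<omega>))"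
proof -
  let ?V = "{v :: 'a list. set v \<subseteq> UNIV \<and> length v = l}"
  let ?N = "\<lambda>(v, m). {\<omega>. past 0 \<omega> \<in> cylinder v \<and> K (past 0 \<omega>) = m}"
  let ?I = "{(v, m) \<in> ?V \<times> range K. \<not> pos v m}"
  have "finite ?I"
    by (rule finite_subset[of _ "?V \<times> range K"])
      (use finite_lists_length_eq[of "UNIV :: 'a set" l] finite_range in auto)
  have "(\<Union>i\<in>?I. ?N i) \<in> null_sets P"
  proof (rule null_sets_UN'[OF countable_finite[OF \<open>finite ?I\<close>]])
    fix i assume i: "i \<in> ?I"
    obtain v m where [simp]: "i = (v, m)" by (cases i)
    have "prob (?N i) = 0"
      using i by (auto simp: pos_def zero_less_measure_iff)
    moreover have "?N i \<in> events" by (auto intro!: events_Collect)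
    ultimately show "?N i \<in> null_sets P" by (auto simp: emeasure_eq_measure)
  qed
  moreover have "\<omega> \<in> (\<Union>i\<in>?I. ?N i)"
    if "\<not> pos (map (past 0 \<omega>) [0..<l]) (K (past 0 \<omega>))" for \<omega>
  proof (rule UN_I)
    show "(map (past 0 \<omega>) [0..<l], K (past 0 \<omega>)) \<in> ?I" using that by simp
  qed (simp add: cylinder_def)
  ultimately show ?thesis
    by (intro AE_I'[of "\<Union>i\<in>?I. ?N i"]) blast+
qed

section \<open>The Markov condition as synchronization of states by words\<close>

definition markov_at :: "nat \<Rightarrow> bool" where
  "markov_at l \<longleftrightarrow> (\<forall>x. AE \<omega> in P.
       real_cond_exp P (word_algebra P l) (indicat_real {\<omega>. \<omega> 0 = x}) \<omega> =
       real_cond_exp P (past_algebra P) (indicat_real {\<omega>. \<omega> 0 = x}) \<omega>)"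

lemma cond_symbol_AE:
  "AE \<omega> in P. measure (K (past 0 \<omega>)) (cylinder [x]) =
     real_cond_exp P (past_algebra P) (indicat_real {\<omega>. \<omega> 0 = x}) \<omega>"
  using cond_future_AE[OF sets_cylinder[of "[x]"]] by (simp add: cylinder_Cons future_zero)

lemma measurable_word_algebra: "word (- int l) 0 \<in> word_algebra P l \<rightarrow>\<^sub>M count_space UNIV"
  unfolding word_algebra_def by (rule measurable_vimage_algebra1) simp

lemma subalgebra_word: "subalgebra (past_algebra P) (word_algebra P l)"
proof -
  have "word (- int l) 0 \<in> past_algebra P \<rightarrow>\<^sub>M count_space UNIV"
    unfolding measurable_count_space_eq2_countable
  proof (intro conjI ballI)
    fix w :: "'a list"
    \<comment> \<open>The word always has length \<open>l\<close>, so lists of any other length have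
      empty preimage.\<close>
    have *: "word (- int l) 0 -` {w} = (if length w = l then past 0 -` cylinder (rev w) else {})"
      using word_eq_iff_cylinder[of "rev w"] by (auto simp: word_def)
    show "word (- int l) 0 -` {w} \<inter> space (past_algebra P) \<in> sets (past_algebra P)"
      unfolding * using measurable_sets[OF measurable_past_algebra sets_cylinder[of "rev w"]] by simp
  qed simp
  then show ?thesis
    unfolding subalgebra_def word_algebra_def
    by (auto simp: sets_vimage_algebra2 past_algebra_def dest: measurable_sets)
qed

text \<open>Each level set of \<open>f\<close> is the preimage of a set of words, so it cannot
  separate sequences with the same word.\<close>

lemma word_algebra_factor:
  fixes f :: "(int \<Rightarrow> 'a) \<Rightarrow> real"
  assumes "f \<in> borel_measurable (word_algebra P l)"
    and "word (- int l) 0 \<omega> = word (- int l) 0 \<omega>'"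
  shows "f \<omega> = f \<omega>'"
proof -
  have "f -` {f \<omega>} \<inter> space (word_algebra P l) \<in> sets (word_algebra P l)"
    using assms(1) by (rule measurable_sets) simp
  then obtain A where "f -` {f \<omega>} = word (- int l) 0 -` A"
    by (auto simp: word_algebra_def sets_vimage_algebra2)
  then have "\<omega>' \<in> f -` {f \<omega>}" using assms(2) by (metis vimageI vimage_eq singletonI)
  then show ?thesis by simp
qed

text \<open>Conditioning on the word gives a function of the word, and conditioning on the whole
  past gives the next-symbol law of the causal state. They agree almost surely exactly if that law
  is constant on the states that can follow a given word.\<close>

lemma markov_at_iff_next_symbol:
  "markov_at l \<longleftrightarrow> (\<forall>v m m' x. length v = l \<longrightarrow> pos v m \<longrightarrow> pos v m' \<longrightarrow>
     measure m (cylinder [x]) = measure m' (cylinder [x]))"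
proof (intro iffI allI impI)
  fix v m m' x assume "markov_at l" and l: "length v = l" and pos: "pos v m" "pos v m'"
  let ?g = "real_cond_exp P (word_algebra P l) (indicat_real {\<omega>. \<omega> 0 = x})"
  have ae: "AE \<omega> in P. ?g \<omega> = measure (K (past 0 \<omega>)) (cylinder [x])"
    using \<open>markov_at l\<close>[unfolded markov_at_def, rule_format, of x] cond_symbol_AE[of x]
    by eventually_elim simp
  \<comment> \<open>An event of positive probability must meet the almost sure set where
    \<open>?g\<close> is the next-symbol law of the state.\<close>
  have ex: "\<exists>\<omega>. past 0 \<omega> \<in> cylinder v \<and> ?g \<omega> = measure n (cylinder [x])" if n: "pos v n" for n
  proof (rule ccontr)
    assume neg: "\<not> ?thesis"
    have "AE \<omega> in P. \<omega> \<notin> {\<omega>. past 0 \<omega> \<in> cylinder v \<and> K (past 0 \<omega>) = n}"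
      using ae by eventually_elim (use neg in auto)
    moreover have "{\<omega>. past 0 \<omega> \<in> cylinder v \<and> K (past 0 \<omega>) = n} \<in> events"
      by (rule events_Collect) measurable
    ultimately have "prob {\<omega>. past 0 \<omega> \<in> cylinder v \<and> K (past 0 \<omega>) = n} = 0"
      using AE_iff_measurable[of "{\<omega>. past 0 \<omega> \<in> cylinder v \<and> K (past 0 \<omega>) = n}" P
          "\<lambda>\<omega>. \<omega> \<notin> {\<omega>. past 0 \<omega> \<in> cylinder v \<and> K (past 0 \<omega>) = n}"]
      by (auto simp: emeasure_eq_measure)
    with n show False by (simp add: pos_def)
  qed
  from ex[OF pos(1)] ex[OF pos(2)] obtain \<omega> \<omega>'
    where "past 0 \<omega> \<in> cylinder v" "?g \<omega> = measure m (cylinder [x])"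
      "past 0 \<omega>' \<in> cylinder v" "?g \<omega>' = measure m' (cylinder [x])" by blast
  moreover from this have "?g \<omega> = ?g \<omega>'"
    using l by (intro word_algebra_factor[of _ l]) (auto simp flip: word_eq_iff_cylinder)
  ultimately show "measure m (cylinder [x]) = measure m' (cylinder [x])" by simp
next
  assume *: "\<forall>v m m' x. length v = l \<longrightarrow> pos v m \<longrightarrow> pos v m' \<longrightarrow>
     measure m (cylinder [x]) = measure m' (cylinder [x])"
  show "markov_at l" unfolding markov_at_def
  proof
    fix x :: 'a
    let ?f = "indicat_real {\<omega>. \<omega> 0 = x}"
    let ?E = "real_cond_exp P (past_algebra P) ?f"
    \<comment> \<open>By assumption the chosen state does not affect the value; for words of
      probability zero the value is arbitrary.\<close>
    define h where "h w = measure (SOME m. pos (rev w) m) (cylinder [x])" for w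
    have f: "integrable P ?f"
      by (auto simp: emeasure_eq_measure intro!: events_Collect)
    have sub: "subalgebra P (word_algebra P l)"
      using subalgebra_past subalgebra_word[of l] by (auto simp: subalgebra_def)
    interpret W: finite_measure_subalgebra P "word_algebra P l"
      by unfold_locales (rule sub)
    have hW: "(\<lambda>\<omega>. h (word (- int l) 0 \<omega>)) \<in> borel_measurable (word_algebra P l)"
      using measurable_word_algebra by (rule measurable_compose) simp
    have hP: "(\<lambda>\<omega>. h (word (- int l) 0 \<omega>)) \<in> borel_measurable P"
      using measurable_from_subalg[OF sub hW] .
    have hE: "AE \<omega> in P. ?E \<omega> = h (word (- int l) 0 \<omega>)"
      using cond_symbol_AE[of x] AE_pos[of l]
    proof eventually_elim
      case (elim \<omega>)
      have "pos (map (past 0 \<omega>) [0..<l]) (SOME m. pos (map (past 0 \<omega>) [0..<l]) m)"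
        using elim(2) by (rule someI)
      from *[rule_format, OF _ elim(2) this, of x] elim(1)
      show ?case by (simp add: h_def word_eq_rev_past)
    qed
    have EP: "?E \<in> borel_measurable P" by simp
    have "integrable P (\<lambda>\<omega>. h (word (- int l) 0 \<omega>))"
      using integrable_cong_AE[OF EP hP hE] past.real_cond_exp_int(1)[OF f] by simp
    \<comment> \<open>Tower property: conditioning on the word factors through \<open>?E\<close>,
      which is almost surely the word-measurable function \<open>h\<close> and so is left
      unchanged.\<close>
    from W.real_cond_exp_nested_subalg[OF subalgebra_past subalgebra_word f]
      W.real_cond_exp_cong[OF hE EP hP] W.real_cond_exp_F_meas[OF this hW] hE
    show "AE \<omega> in P. real_cond_exp P (word_algebra P l) ?f \<omega> = ?E \<omega>"
      by eventually_elim simp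
  qed
qed

lemma markov_at_iff_pos:
  "markov_at l \<longleftrightarrow> (\<forall>v m m'. length v = l \<longrightarrow> pos v m \<longrightarrow> pos v m' \<longrightarrow> m = m')"
proof
  assume "\<forall>v m m'. length v = l \<longrightarrow> pos v m \<longrightarrow> pos v m' \<longrightarrow> m = m'"
  then show "markov_at l" unfolding markov_at_iff_next_symbol by blast
next
  assume "markov_at l"
  then have next_eq: "measure m (cylinder [x]) = measure m' (cylinder [x])"
    if "length v = l" "pos v m" "pos v m'" for v m m' x
    using that unfolding markov_at_iff_next_symbol by blast
  have "measure m (cylinder u) = measure m' (cylinder u)"
    if "length v = l" "pos v m" "pos v m'" for v m m' u
    using that
  proof (induction u arbitrary: v m m')
    case Nil
    then show ?case using pos_range[of v m] pos_range[of v m'] by auto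
  next
    case (Cons x u)
    note eq = next_eq[OF Cons.prems, of x]
    show ?case
    proof (cases "measure m (cylinder [x]) > 0")
      case True
      with eq have True': "measure m' (cylinder [x]) > 0" by simp
      obtain n n' where n: "edge m x n" "pos (x # v) n" and n': "edge m' x n'" "pos (x # v) n'"
        using pos_extend[OF Cons.prems(2) True] pos_extend[OF Cons.prems(3) True'] by blast
      \<comment> \<open>The extended word \<open>x # v\<close> has length \<open>l + 1\<close>.
        Dropping its oldest symbol restores length \<open>l\<close>, so the induction hypothesis
        applies to the successors.\<close>
      have "measure n (cylinder u) = measure n' (cylinder u)"
        using pos_butlast[OF n(2)] pos_butlast[OF n'(2)]
        by (rule Cons.IH[rotated]) (simp add: Cons.prems(1) del: butlast.simps)
      then show ?thesis
        using edge_future(2)[OF n(1), of u] edge_future(2)[OF n'(1), of u] eq by simp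
    next
      case False
      \<comment> \<open>No successor exists here: \<open>x\<close> is impossible from both states,
        so both sides vanish.\<close>
      have "measure n (cylinder (x # u)) = 0" if "pos v n" "measure n (cylinder [x]) = 0" for n
      proof -
        obtain p where p: "n = K p" using pos_range[OF \<open>pos v n\<close>] by blast
        interpret n: prob_space n using K_in_prob_algebra[of p] by (simp add: p space_prob_algebra)
        have "measure n (cylinder (x # u)) \<le> measure n (cylinder [x])"
          using K_in_prob_algebra[of p]
          by (intro n.finite_measure_mono) (auto simp: cylinder_Cons p space_prob_algebra)
        with that(2) show ?thesis using measure_nonneg[of n "cylinder (x # u)"] by linarith
      qed
      then show ?thesis
        using False eq Cons.prems by (metis zero_less_measure_iff)
    qed
  qed
  then show "\<forall>v m m'. length v = l \<longrightarrow> pos v m \<longrightarrow> pos v m' \<longrightarrow> m = m'"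
    by (blast intro: K_eqI pos_range)
qed

lemma markov_order_eq: "markov_order P = Inf {enat l | l. markov_at l}"
  by (simp add: markov_order_def markov_at_def)

end

section \<open>From causal states to the labeled graph\<close>

text \<open>As in \<open>past\<close>, the labels of the path are listed backwards: the last symbol comes first.\<close>

fun reach :: "('q, 'a) hmm \<Rightarrow> 'a list \<Rightarrow> 'q set" where
  "reach M [] = states M"
| "reach M (x # v) = {s' \<in> states M. \<exists>s\<in>reach M v. tprob M s x s' > 0}"

lemma reach_subset: "reach M v \<subseteq> states M"
  by (cases v) auto

text \<open>Only the signs of transition probabilities between states enter \<open>reach\<close>,
  and it never leaves \<open>states M\<close>, where the signs agree.\<close>

lemma reach_cong:
  assumes "states M = states M'"
    and "\<And>s x s'. s \<in> states M \<Longrightarrow> s' \<in> states M \<Longrightarrow> tprob M s x s' > 0 \<longleftrightarrow> tprob M' s x s' > 0"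
  shows "reach M v = reach M' v"
proof (induction v)
  case (Cons x v)
  have "(\<exists>s\<in>reach M v. tprob M s x s' > 0) \<longleftrightarrow> (\<exists>s\<in>reach M v. tprob M' s x s' > 0)"
    if "s' \<in> states M" for s'
    using assms(2)[OF _ that] reach_subset[of M v] by blast
  then show ?case using Cons assms(1) by auto
qed (simp add: assms)

text \<open>The right-hand side mentions no process and no numerical probability, only which
  transitions are positive.\<close>

lemma markov_order_reach:
  fixes P :: "(int \<Rightarrow> 'a::finite) measure" and M :: "('q, 'a) hmm"
  assumes "stationary_process P" and "finite_epsilon_machine P M"
  shows "markov_order P =
    Inf {enat l | l. \<forall>v s s'. length v = l \<longrightarrow> s \<in> reach M v \<longrightarrow> s' \<in> reach M v \<longrightarrow> s = s'}"
proof -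
  obtain K c where K: "cond_future_dist P K" and fin: "finite (UNIV // causal_equiv K)"
    and M: "epsilon_machine_via P K c M"
    using assms(2) by (auto simp: finite_epsilon_machine_def)
  have eq_class: "causal_equiv K `` {p} = {p'. K p' = K p}" for p
    by (auto simp: causal_equiv_def)
  have "range K \<subseteq> (\<lambda>C. K (SOME p. p \<in> C)) ` (UNIV // causal_equiv K)"
  proof
    fix m assume "m \<in> range K"
    then obtain p where p: "m = K p" by blast
    have "K (SOME p'. p' \<in> causal_equiv K `` {p}) = K p"
      using someI[of "\<lambda>p'. p' \<in> causal_equiv K `` {p}" p] by (simp add: eq_class)
    then show "m \<in> (\<lambda>C. K (SOME p. p \<in> C)) ` (UNIV // causal_equiv K)"
      using p by (intro image_eqI[of _ _ "causal_equiv K `` {p}"]) (simp_all add: quotientI)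
  qed
  then have "finite (range K)" using fin by (rule finite_surj[rotated])
  with assms(1) K interpret causal_process P K by unfold_locales
  \<comment> \<open>The future law shared by all pasts in the causal state \<open>c s\<close>; the
    choice of the past is immaterial because \<open>K\<close> is constant on the class.\<close>
  define k where "k s = K (SOME p. p \<in> c s)" for s
  have bij: "bij_betw c (states M) (positive_causal_states P K)"
    using M by (simp add: epsilon_machine_via_def)
  have tp: "tprob M s x s' =
        \<P>(\<omega> in P. \<omega> 0 = x \<and> causal_state K 1 \<omega> = c s' \<bar> causal_state K 0 \<omega> = c s)"
    if "s \<in> states M" "s' \<in> states M" for s x s'
    using M that by (auto simp: epsilon_machine_via_def)
  have cs: "c s = {p. K p = k s}" "k s \<in> range K" if s: "s \<in> states M" for s
  proof -
    have "c s \<in> UNIV // causal_equiv K"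
      using bij s by (auto simp: bij_betw_def positive_causal_states_def)
    then obtain p where p: "c s = {p'. K p' = K p}" by (auto simp: quotient_def eq_class)
    have "K (SOME p'. p' \<in> c s) = K p"
      using someI[of "\<lambda>p'. p' \<in> c s" p] by (simp add: p)
    then show "c s = {p. K p = k s}" "k s \<in> range K" using p by (simp_all add: k_def)
  qed
  have state_iff: "causal_state K t \<omega> = c s \<longleftrightarrow> K (past t \<omega>) = k s" if "s \<in> states M" for t \<omega> s
  proof -
    have "{p. K p = K (past t \<omega>)} = {p. K p = k s} \<longleftrightarrow> K (past t \<omega>) = k s"
      by auto
    then show ?thesis by (simp add: causal_state_def eq_class cs(1)[OF that])
  qed
  have pos_state: "prob {\<omega>. K (past 0 \<omega>) = k s} > 0" if s: "s \<in> states M" for s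
    using bij_betw_apply[OF bij s] s by (simp add: positive_causal_states_def state_iff)
  have inj: "inj_on k (states M)"
    using bij cs(1) unfolding bij_betw_def inj_on_def by metis
  \<comment> \<open>The conditioning event has positive probability by \<open>pos_state\<close>, so
    the conditional and the joint probability have the same sign.\<close>
  have edge: "edge (k s) x (k s') \<longleftrightarrow> tprob M s x s' > 0"
    if "s \<in> states M" "s' \<in> states M" for s x s'
    using that pos_state[of s]
    by (simp add: tp cond_prob_def state_iff edge_def zero_less_divide_iff conj_ac)
  have pos_Nil: "pos [] m \<longleftrightarrow> m \<in> k ` states M" for m
  proof
    assume "pos [] m"
    then have m: "prob {\<omega>. K (past 0 \<omega>) = m} > 0" "m \<in> range K"
      using pos_range[of "[]" m] by (simp_all add: pos_def)
    then obtain p where p: "m = K p" by blast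
    have "causal_state K 0 \<omega> = causal_equiv K `` {p} \<longleftrightarrow> K (past 0 \<omega>) = m" for \<omega>
      by (auto simp: causal_state_def eq_class p)
    with m(1) have "causal_equiv K `` {p} \<in> positive_causal_states P K"
      by (simp add: positive_causal_states_def quotientI)
    then obtain s where s: "s \<in> states M" "causal_equiv K `` {p} = c s"
      using bij_betw_imp_surj_on[OF bij] by (metis imageE)
    have "p \<in> c s" by (simp add: eq_class flip: s(2))
    with cs(1)[OF s(1)] have "m = k s" by (simp add: p)
    with s show "m \<in> k ` states M" by simp
  qed (use pos_state in \<open>auto simp: pos_def\<close>)
  have pos_reach: "pos v m \<longleftrightarrow> m \<in> k ` reach M v" for v m
  proof (induction v arbitrary: m)
    case (Cons x v)
    \<comment> \<open>\<open>reach\<close> admits only named states as targets. A state that follows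
      \<open>x # v\<close> with positive probability has positive probability itself, so it has a
      name.\<close>
    have "m \<in> k ` states M" if "pos (x # v) m"
      using that unfolding pos_Nil[symmetric] pos_def by (rule prob_pos_mono[rotated]) auto
    then show ?case
      using edge reach_subset[of M v] by (fastforce simp: pos_Cons Cons.IH)
  qed (simp add: pos_Nil)
  have "markov_at l \<longleftrightarrow>
      (\<forall>v s s'. length v = l \<longrightarrow> s \<in> reach M v \<longrightarrow> s' \<in> reach M v \<longrightarrow> s = s')" for l
    using inj reach_subset[of M] unfolding markov_at_iff_pos pos_reach inj_on_def by blast
  then show ?thesis by (simp add: markov_order_eq)
qed

theorem corollary2:
  fixes P P' :: "(int \<Rightarrow> 'a::finite) measure"
    and M M' :: "('q, 'a) hmm"
  assumes "stationary_process P" and "stationary_process P'"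
    and "finite_epsilon_machine P M" and "finite_epsilon_machine P' M'"
    and "states M = states M'"
    and "\<And>s x s'. s \<in> states M \<Longrightarrow> s' \<in> states M \<Longrightarrow>
           tprob M s x s' > 0 \<longleftrightarrow> tprob M' s x s' > 0"
  shows "markov_order P = markov_order P'"
proof -
  have "reach M v = reach M' v" for v
    using assms(5,6) by (rule reach_cong)
  then show ?thesis
    using assms(1-4) by (simp add: markov_order_reach)
qed

end
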